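(* There are infinitely many pairwise non-isomorphic $3$-dicritical oriented graphs.
   Context: All digraphs are finite. An oriented graph is a digraph without loops, without parallel arcs and without directed $2$-cycles. A $k$-coloring of a digraph $D$ is a mapping from the vertices of $D$ to $\{1,\dots,k\}$ such that each color class induces an acyclic digraph (no directed cycle). The dichromatic number $\chi_d(D)$ is the minimum integer $k$ such that $D$ admits a $k$-coloring. A digraph $D$ is $k$-dicritical if $\chi_d(D)\ge k$ but $\chi_d(D')<k$ for every proper subdigraph $D'$ of $D$. *)

theory Defs
  imports "Graph_Theory.Graph_Theory" "HOL-Library.FuncSet"
begin

text \<open>\<^locale>\<open>digraph\<close> already excludes infinite digraphs, loops and parallel arcs.\<close>

locale oriented_graph = digraph +
  assumes no_two_cycles: "u \<rightarrow>\<^bsub>G\<^esub> v \<Longrightarrow> \<not> v \<rightarrow>\<^bsub>G\<^esub> u"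

text \<open>
  \<^const>\<open>pre_digraph.cycle\<close> is the directed notion; loops and 2-cycles count as cycles.
\<close>

definition acyclic_digraph :: "('a, 'b) pre_digraph \<Rightarrow> bool" where
  "acyclic_digraph D \<longleftrightarrow> (\<nexists>p. pre_digraph.cycle D p)"

definition dicoloring :: "('a, 'b) pre_digraph \<Rightarrow> nat \<Rightarrow> ('a \<Rightarrow> nat) \<Rightarrow> bool" where
  "dicoloring D k c \<longleftrightarrow>
     c \<in> verts D \<rightarrow> {1..k} \<and>
     (\<forall>i\<in>{1..k}. acyclic_digraph (D \<restriction> {v \<in> verts D. c v = i}))"

text \<open>
  The minimum exists for every finite loopless digraph (give all vertices distinct colors),
  in particular for every subdigraph of an oriented graph.
  It is unspecified if \<open>D\<close> has a loop.
\<close>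

definition dichromatic_number :: "('a, 'b) pre_digraph \<Rightarrow> nat" where
  "dichromatic_number D = (LEAST k. \<exists>c. dicoloring D k c)"

text \<open>
  A \<^const>\<open>subgraph\<close> shares the total functions \<^const>\<open>tail\<close> and \<^const>\<open>head\<close> with its host,
  so \<open>H \<noteq> D\<close> means precisely that a vertex or an arc is missing from \<open>H\<close>.
\<close>

definition dicritical :: "nat \<Rightarrow> ('a, 'b) pre_digraph \<Rightarrow> bool" where
  "dicritical k D \<longleftrightarrow>
     dichromatic_number D \<ge> k \<and>
     (\<forall>H. subgraph H D \<and> H \<noteq> D \<longrightarrow> dichromatic_number H < k)"

end

theory Submission
  imports Defs
begin

text \<open>
  It suffices to find 3-dicritical oriented graphs with arbitrarily many vertices, because
  isomorphic digraphs have equally many. Every oriented graph that is not 2-colorable contains a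
  3-dicritical subdigraph, namely a smallest subdigraph that is not 2-colorable, and this
  subdigraph has to contain each vertex whose deletion makes the host 2-colorable. So one needs,
  for each \<open>n\<close>, an oriented graph that is not 2-colorable but has more than \<open>n\<close> such vertices.

  The host is a repeated directed Hajos join of copies of the Paley tournament on
  \<open>\<int>/7\<int>\<close>, whose arcs are \<open>x \<rightarrow> x + 1\<close>, \<open>x \<rightarrow> x + 2\<close> and \<open>x \<rightarrow> x + 4\<close>. That tournament is not
  2-colorable: of its seven vertices four share a color, an acyclic set of four vertices would
  have a source dominating the other three, and the three out-neighbors
  \<open>x + 1\<close>, \<open>x + 2\<close>, \<open>x + 4\<close> of any vertex form a directed triangle. Delete the arc
  \<open>6 \<rightarrow> 0\<close>. In every 2-coloring of what is left there is a monochromatic path from \<open>0\<close> to \<open>6\<close>,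
  since the deleted arc has to close a monochromatic cycle. Glue \<open>n\<close> copies
  in a row, the vertex \<open>6\<close> of each being the vertex \<open>0\<close> of the next, and add one arc from the
  last vertex to the first (\<open>paley_chain\<close>). The monochromatic paths of the copies join up
  (\<open>mono_path_in_link\<close>) and the added arc closes them to a cycle, so the chain is not 2-colorable.

  Number the vertices of the chain consecutively and color them by parity. Within a copy the arcs
  that lead upwards in the numbering have length 1, 2 or 4 and those that lead downwards have the
  odd lengths 3 or 5, so the only monochromatic arc of the chain that leads downwards is the added
  one. After the deletion of a vertex \<open>6 * j\<close> at which copies are glued, no monochromatic walk
  gets from the first to the last vertex any more, and the parity coloring is proper
  (\<open>dichromatic_number_without_joint\<close>).
\<close>

section \<open>Colorings and acyclicity of the monochromatic arcs\<close>

text \<open>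
  Cycles are simple closed walks, but every nonempty closed walk contains a cycle. Acyclicity
  thus depends only on the relation between end vertices, where closed walks can be composed
  and be excluded by a rank function.
\<close>

lemma acyclic_digraph_iff:
  assumes "wf_digraph D"
  shows "acyclic_digraph D \<longleftrightarrow> acyclic (arcs_ends D)"
proof -
  interpret wf_digraph D by fact
  have "(\<exists>p. cycle p) \<longleftrightarrow> (\<exists>p. closed_w p)"
    using closed_w_imp_cycle cycle_altdef by blast
  also have "\<dots> \<longleftrightarrow> (\<exists>u. u \<rightarrow>\<^sup>+\<^bsub>D\<^esub> u)"
    unfolding closed_w_def reachable1_awalk by auto
  finally show ?thesis
    unfolding acyclic_digraph_def acyclic_def by auto
qed

definition mono_arcs :: "('a, 'b) pre_digraph \<Rightarrow> ('a \<Rightarrow> nat) \<Rightarrow> 'a rel" where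
  "mono_arcs D c = {(u, v) \<in> arcs_ends D. c u = c v}"

text \<open>
  All color classes can be tested at once, as a walk along monochromatic arcs never leaves the
  class in which it starts.
\<close>

lemma dicoloring_iff_acyclic_mono_arcs:
  assumes "wf_digraph D"
  shows "dicoloring D k c \<longleftrightarrow> c \<in> verts D \<rightarrow> {1..k} \<and> acyclic (mono_arcs D c)"
proof -
  interpret wf_digraph D by fact
  define M where "M i = {(u, v) \<in> arcs_ends D. c u = i \<and> c v = i}" for i
  have ends: "arcs_ends (D \<restriction> {v \<in> verts D. c v = i}) = M i" for i
    by (auto simp: M_def arcs_ends_def arc_to_ends_def)
  have dic: "dicoloring D k c \<longleftrightarrow> c \<in> verts D \<rightarrow> {1..k} \<and> (\<forall>i\<in>{1..k}. acyclic (M i))"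
    unfolding dicoloring_def
    by (simp add: acyclic_digraph_iff[OF wellformed_induce_subgraph] ends)
  have one_class: "(u, v) \<in> (M (c u))\<^sup>+ \<and> c v = c u" if "(u, v) \<in> (mono_arcs D c)\<^sup>+" for u v
    using that
  proof (induction rule: trancl_induct)
    case (base v)
    then show ?case by (auto simp: mono_arcs_def M_def)
  next
    case (step v w)
    then have "(v, w) \<in> M (c u)" "c w = c u" by (auto simp: mono_arcs_def M_def)
    with step.IH show ?case by (auto intro: trancl_into_trancl)
  qed
  have "acyclic (mono_arcs D c)"
    if col: "c \<in> verts D \<rightarrow> {1..k}" and ac: "\<forall>i\<in>{1..k}. acyclic (M i)"
    unfolding acyclic_def
  proof (intro allI notI)
    fix u
    assume cyc: "(u, u) \<in> (mono_arcs D c)\<^sup>+"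
    then obtain v where "(u, v) \<in> mono_arcs D c" by (meson tranclD)
    then have "u \<in> verts D" by (auto simp: mono_arcs_def arcs_ends_def arc_to_ends_def)
    with col have "c u \<in> {1..k}" by auto
    with ac one_class[OF cyc] show False by (auto simp: acyclic_def)
  qed
  moreover have "acyclic (M i)" if "acyclic (mono_arcs D c)" for i
    using that by (rule acyclic_subset) (auto simp: M_def mono_arcs_def)
  ultimately show ?thesis using dic by blast
qed

text \<open>
  Some coloring has to be supplied, because the dichromatic number is an unspecified \<open>LEAST\<close> for
  a digraph without any.
\<close>

lemma dichromatic_number_gt:
  assumes "wf_digraph D" and "dicoloring D m c" and none: "\<And>c. \<not> dicoloring D k c"
  shows "k < dichromatic_number D"
proof (rule ccontr)
  assume "\<not> k < dichromatic_number D"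
  moreover have "\<exists>c. dicoloring D (dichromatic_number D) c"
    unfolding dichromatic_number_def by (rule LeastI_ex) (use assms(2) in blast)
  ultimately obtain j c' where "j \<le> k" "dicoloring D j c'"
    using not_less by blast
  then have "dicoloring D k c'"
    unfolding dicoloring_iff_acyclic_mono_arcs[OF assms(1)] by fastforce
  with none show False by blast
qed

lemma dichromatic_number_le: "dicoloring D k c \<Longrightarrow> dichromatic_number D \<le> k"
  unfolding dichromatic_number_def by (auto intro: Least_le)

section \<open>Dicritical subdigraphs\<close>

text \<open>
  Take a subdigraph of dichromatic number at least \<open>k\<close> with as few vertices and arcs as possible:
  a proper subdigraph of it has fewer, hence a smaller dichromatic number.
\<close>

lemma ex_dicritical_subgraph:
  assumes "fin_digraph D" and "k \<le> dichromatic_number D"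
  obtains H where "subgraph H D" and "dicritical k H"
proof -
  interpret fin_digraph D by fact
  define size :: "('a, 'b) pre_digraph \<Rightarrow> nat"
    where "size H = card (verts H) + card (arcs H)" for H
  define bad where "bad H \<longleftrightarrow> subgraph H D \<and> k \<le> dichromatic_number H" for H
  have "bad D" using assms(2) by (simp add: bad_def subgraph_refl)
  then obtain H where H: "bad H" and least: "\<And>H'. bad H' \<Longrightarrow> size H \<le> size H'"
    using ex_has_least_nat[of bad D size] by blast
  have fin: "finite (verts H)" "finite (arcs H)"
    using H finite_subset[OF _ finite_verts] finite_subset[OF _ finite_arcs]
    by (auto simp: bad_def subgraph_def)
  have "dichromatic_number H' < k" if sub: "subgraph H' H" and ne: "H' \<noteq> H" for H'
  proof (rule ccontr)
    assume "\<not> dichromatic_number H' < k"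
    with H sub have "bad H'" by (auto simp: bad_def intro: subgraph_trans)
    then have "size H \<le> size H'" by (rule least)
    moreover have le: "card (verts H') \<le> card (verts H)" "card (arcs H') \<le> card (arcs H)"
      using sub fin by (auto simp: subgraph_def intro: card_mono)
    ultimately have "card (verts H') = card (verts H)" "card (arcs H') = card (arcs H)"
      by (auto simp: size_def)
    with sub fin have "verts H' = verts H" "arcs H' = arcs H"
      by (auto simp: subgraph_def dest: card_subset_eq)
    with sub ne show False by (auto simp: subgraph_def compatible_def)
  qed
  with H show thesis by (intro that[of H]) (auto simp: bad_def dicritical_def)
qed

lemma oriented_graph_subgraph:
  assumes "oriented_graph D" and "subgraph H D"
  shows "oriented_graph H"
proof -
  interpret oriented_graph D by fact
  have "arcs_ends H \<subseteq> arcs_ends D" using assms(2) by (rule arcs_ends_mono)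
  then show ?thesis
    using digraph_subgraph[OF assms(2)] no_two_cycles
    by (auto simp: oriented_graph_def oriented_graph_axioms_def)
qed

section \<open>Chains of seven-vertex Paley tournaments\<close>

text \<open>
  With representatives \<open>0, \<dots>, 6\<close>, the arcs \<open>x \<rightarrow> x + 1\<close>, \<open>x \<rightarrow> x + 2\<close>, \<open>x \<rightarrow> x + 4\<close> of the Paley
  tournament on \<open>\<int>/7\<int>\<close> that wrap around become the steps \<open>1 - 7 = -6\<close>, \<open>2 - 7 = -5\<close> and
  \<open>4 - 7 = -3\<close>. The only step \<open>-6\<close> is the arc from \<open>6\<close> to \<open>0\<close>, which is left out.
\<close>

definition paley_link_arcs :: "(nat \<times> nat) set" where
  "paley_link_arcs = {(a, b). a \<le> 6 \<and> b \<le> 6 \<and>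
     (b = a + 1 \<or> b = a + 2 \<or> b = a + 4 \<or> a = b + 3 \<or> a = b + 5)}"

definition paley_chain :: "nat \<Rightarrow> (nat, nat \<times> nat) pre_digraph" where
  "paley_chain n = \<lparr>verts = {0..6 * n},
     arcs = insert (6 * n, 0) {(6 * i + a, 6 * i + b) | i a b. i < n \<and> (a, b) \<in> paley_link_arcs},
     tail = fst, head = snd\<rparr>"

lemma arcs_ends_paley_chain: "arcs_ends (paley_chain n) = arcs (paley_chain n)"
  by (simp add: arcs_ends_def arc_to_ends_def paley_chain_def)

lemma paley_chain_arcE:
  assumes "(u, v) \<in> arcs (paley_chain n)"
  obtains "u = 6 * n" "v = 0"
    | i a b where "i < n" "u = 6 * i + a" "v = 6 * i + b" "(a, b) \<in> paley_link_arcs"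
  using assms by (auto simp: paley_chain_def)

text \<open>
  For \<open>n = 0\<close> the closing arc would be a loop. Otherwise no two arcs are opposite, because the
  steps \<open>1, 2, 4, -3, -5\<close> and the closing step \<open>-6 * n\<close> are nonzero and no two of them add up
  to zero.
\<close>

lemma oriented_graph_paley_chain:
  assumes "0 < n"
  shows "oriented_graph (paley_chain n)"
proof -
  have bound: "arcs (paley_chain n) \<subseteq> {0..6 * n} \<times> {0..6 * n}"
    by (auto simp: paley_chain_def paley_link_arcs_def)
  have diff: "v = u + 1 \<or> v = u + 2 \<or> v = u + 4 \<or> u = v + 3 \<or> u = v + 5 \<or> u = 6 * n \<and> v = 0"
    if "(u, v) \<in> arcs (paley_chain n)" for u v
    using that by (elim paley_chain_arcE) (auto simp: paley_link_arcs_def)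
  show ?thesis
  proof unfold_locales
    show "finite (arcs (paley_chain n))"
      using bound by (rule finite_subset) simp
  next
    fix u v
    assume "u \<rightarrow>\<^bsub>paley_chain n\<^esub> v"
    then show "\<not> v \<rightarrow>\<^bsub>paley_chain n\<^esub> u"
      unfolding arcs_ends_paley_chain using diff[of u v] diff[of v u] assms by linarith
  next
    fix e
    assume e: "e \<in> arcs (paley_chain n)"
    show "tail (paley_chain n) e \<noteq> head (paley_chain n) e"
      using diff[of "fst e" "snd e"] e assms by (auto simp: paley_chain_def)
    from e bound have "e \<in> {0..6 * n} \<times> {0..6 * n}" by blast
    then show "tail (paley_chain n) e \<in> verts (paley_chain n)"
         "head (paley_chain n) e \<in> verts (paley_chain n)"
      by (auto simp: paley_chain_def)
  qed (auto simp: paley_chain_def arc_to_ends_def)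
qed

text \<open>
  Together with the missing arc from \<open>6\<close> to \<open>0\<close> a link is the Paley tournament, which has a
  monochromatic triangle in every 2-coloring. By assumption no triangle inside the link is
  monochromatic, and just two triangles of the tournament use the missing arc: \<open>6 \<rightarrow> 0 \<rightarrow> 2 \<rightarrow> 6\<close> and
  \<open>6 \<rightarrow> 0 \<rightarrow> 4 \<rightarrow> 6\<close>. The rest of either one is a monochromatic path across the link.
\<close>

lemma mono_path_in_link:
  assumes i: "i < n" and col: "dicoloring (paley_chain n) 2 c"
  shows "(6 * i, 6 * i + 6) \<in> (mono_arcs (paley_chain n) c)\<^sup>+"
proof -
  interpret oriented_graph "paley_chain n" using i by (intro oriented_graph_paley_chain) simp
  let ?M = "mono_arcs (paley_chain n) c"
  define C where "C a \<longleftrightarrow> c (6 * i + a) = 1" for a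
  have ac: "acyclic ?M" and range: "c \<in> verts (paley_chain n) \<rightarrow> {1..2}"
    using col by (auto simp: dicoloring_iff_acyclic_mono_arcs[OF wf_digraph])
  have eq: "c (6 * i + a) = c (6 * i + b)" if "C a = C b" "a \<le> 6" "b \<le> 6" for a b
  proof -
    have "c (6 * i + a) \<in> {1..2}" "c (6 * i + b) \<in> {1..2}"
      using that i range by (auto simp: paley_chain_def)
    with that(1) show ?thesis by (auto simp: C_def)
  qed
  have arc: "(6 * i + a, 6 * i + b) \<in> ?M" if "(a, b) \<in> paley_link_arcs" "C a = C b" for a b
  proof -
    have "(6 * i + a, 6 * i + b) \<in> arcs (paley_chain n)"
      using that(1) i by (auto simp: paley_chain_def)
    moreover have "c (6 * i + a) = c (6 * i + b)"
      using that by (intro eq) (auto simp: paley_link_arcs_def)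
    ultimately show ?thesis by (simp add: mono_arcs_def arcs_ends_paley_chain)
  qed
  have tri: "\<not> (C x = C y \<and> C y = C z)"
    if "(x, y) \<in> paley_link_arcs" "(y, z) \<in> paley_link_arcs" "(z, x) \<in> paley_link_arcs" for x y z
  proof
    assume "C x = C y \<and> C y = C z"
    then have "(6 * i + x, 6 * i + x) \<in> ?M\<^sup>+"
      using arc[OF that(1)] arc[OF that(2)] arc[OF that(3)]
      by (meson trancl.intros)
    with ac show False by (simp add: acyclic_def)
  qed
  \<comment> \<open>The other 12 of the 14 directed triangles of the tournament, which are the translates of
    \<open>0 \<rightarrow> 1 \<rightarrow> 3 \<rightarrow> 0\<close> and \<open>0 \<rightarrow> 2 \<rightarrow> 3 \<rightarrow> 0\<close>; what remains is a finite check of all colorings.\<close>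
  have triangles:
    "\<not> (C 0 = C 1 \<and> C 1 = C 3)" "\<not> (C 1 = C 2 \<and> C 2 = C 4)" "\<not> (C 2 = C 3 \<and> C 3 = C 5)"
    "\<not> (C 3 = C 4 \<and> C 4 = C 6)" "\<not> (C 4 = C 5 \<and> C 5 = C 0)" "\<not> (C 5 = C 6 \<and> C 6 = C 1)"
    "\<not> (C 0 = C 2 \<and> C 2 = C 3)" "\<not> (C 1 = C 3 \<and> C 3 = C 4)" "\<not> (C 2 = C 4 \<and> C 4 = C 5)"
    "\<not> (C 3 = C 5 \<and> C 5 = C 6)" "\<not> (C 5 = C 0 \<and> C 0 = C 1)" "\<not> (C 6 = C 1 \<and> C 1 = C 2)"
    by (rule tri; simp add: paley_link_arcs_def)+
  have "C 0 = C 2 \<and> C 2 = C 6 \<or> C 0 = C 4 \<and> C 4 = C 6"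
    using triangles by argo
  then show ?thesis
  proof
    assume "C 0 = C 2 \<and> C 2 = C 6"
    then show ?thesis
      using arc[of 0 2] arc[of 2 6] by (auto simp: paley_link_arcs_def intro: trancl.intros)
  next
    assume "C 0 = C 4 \<and> C 4 = C 6"
    then show ?thesis
      using arc[of 0 4] arc[of 4 6] by (auto simp: paley_link_arcs_def intro: trancl.intros)
  qed
qed

lemma paley_chain_not_2_dicolorable:
  assumes "0 < n"
  shows "\<not> dicoloring (paley_chain n) 2 c"
proof
  assume col: "dicoloring (paley_chain n) 2 c"
  interpret oriented_graph "paley_chain n" using assms by (rule oriented_graph_paley_chain)
  let ?M = "mono_arcs (paley_chain n) c"
  have path: "(0, 6 * m) \<in> ?M\<^sup>*" if "m \<le> n" for m
    using that
  proof (induction m)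
    case (Suc m)
    then have "(6 * m, 6 * m + 6) \<in> ?M\<^sup>+"
      using mono_path_in_link[OF _ col] by simp
    moreover have "(0, 6 * m) \<in> ?M\<^sup>*" using Suc by simp
    moreover have "6 * Suc m = 6 * m + 6" by simp
    ultimately show ?case by (metis rtrancl_trans trancl_into_rtrancl)
  qed simp
  have same: "c u = c v" if "(u, v) \<in> ?M\<^sup>*" for u v
    using that by induction (auto simp: mono_arcs_def)
  have "(6 * n, 0) \<in> arcs (paley_chain n)" by (simp add: paley_chain_def)
  then have "(6 * n, 0) \<in> ?M"
    using same[OF path[of n]] by (simp add: mono_arcs_def arcs_ends_paley_chain)
  with path[of n] have "(0, 0) \<in> ?M\<^sup>+" by (auto intro: rtrancl_into_trancl1)
  with col show False
    by (auto simp: dicoloring_iff_acyclic_mono_arcs[OF wf_digraph] acyclic_def)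
qed

lemma dichromatic_number_paley_chain:
  assumes "0 < n"
  shows "3 \<le> dichromatic_number (paley_chain n)"
proof -
  interpret oriented_graph "paley_chain n" using assms by (rule oriented_graph_paley_chain)
  have "mono_arcs (paley_chain n) Suc = {}"
    using no_loops by (auto simp: mono_arcs_def arcs_ends_def arc_to_ends_def)
  moreover have "Suc \<in> verts (paley_chain n) \<rightarrow> {1..6 * n + 1}"
    by (auto simp: paley_chain_def)
  ultimately have "dicoloring (paley_chain n) (6 * n + 1) Suc"
    by (simp add: dicoloring_iff_acyclic_mono_arcs[OF wf_digraph] acyclic_def)
  from dichromatic_number_gt[OF wf_digraph this paley_chain_not_2_dicolorable[OF assms]]
  show ?thesis by simp
qed

text \<open>
  The parity coloring works. The closing arc from \<open>6 * n\<close> to \<open>0\<close> stays monochromatic, so the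
  vertices above the missing joint are ranked before those below it; all other monochromatic arcs
  respect this, since they lead upwards within one link and no link has vertices on both sides
  of a joint.
\<close>

lemma dichromatic_number_without_joint:
  assumes H: "subgraph H (paley_chain n)" and j: "j \<le> n" and missing: "6 * j \<notin> verts H"
  shows "dichromatic_number H \<le> 2"
proof -
  interpret H: wf_digraph H using H by (simp add: subgraph_def)
  define c :: "nat \<Rightarrow> nat" where "c v = v mod 2 + 1" for v
  define rank where "rank v = (if v < 6 * j then v + 6 * n + 1 else v)" for v
  have "rank u < rank v" if "(u, v) \<in> mono_arcs H c" for u v
  proof -
    have "(u, v) \<in> arcs_ends H" and par: "u mod 2 = v mod 2"
      using that by (auto simp: mono_arcs_def c_def)
    then have uv: "u \<in> verts H" "v \<in> verts H" and arc: "(u, v) \<in> arcs (paley_chain n)"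
      using arcs_ends_mono[OF H] by (auto simp: arcs_ends_paley_chain dest: H.adj_in_verts)
    have ne: "u \<noteq> 6 * j" "v \<noteq> 6 * j" using uv missing by auto
    from arc show ?thesis
    proof (cases rule: paley_chain_arcE)
      case 1
      with j ne show ?thesis by (auto simp: rank_def)
    next
      case (2 i a b)
      from 2(4) par have "a < b" "b \<le> 6"
        unfolding 2 by (auto simp: paley_link_arcs_def) presburger+
      moreover have "i < j \<or> j \<le> i" by auto
      ultimately show ?thesis using ne 2 j by (auto simp: rank_def)
    qed
  qed
  then have "acyclic (mono_arcs H c)"
    using acyclicI_order[of "(mono_arcs H c)\<inverse>" rank] by auto
  moreover have "c \<in> verts H \<rightarrow> {1..2}" by (auto simp: c_def)
  ultimately have "dicoloring H 2 c"
    by (simp add: dicoloring_iff_acyclic_mono_arcs[OF H.wf_digraph])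
  then show ?thesis by (rule dichromatic_number_le)
qed

text \<open>
  A 3-dicritical subdigraph of the chain with \<open>n + 1\<close> links contains all of its \<open>n + 2\<close> joints.
\<close>

lemma ex_large_3_dicritical_oriented_graph:
  "\<exists>H :: (nat, nat \<times> nat) pre_digraph. oriented_graph H \<and> dicritical 3 H \<and> n < card (verts H)"
proof -
  interpret oriented_graph "paley_chain (Suc n)" by (rule oriented_graph_paley_chain) simp
  obtain H where H: "subgraph H (paley_chain (Suc n))" "dicritical 3 H"
    using ex_dicritical_subgraph[OF fin_digraph_axioms dichromatic_number_paley_chain] by auto
  have "6 * j \<in> verts H" if "j \<le> Suc n" for j
    using dichromatic_number_without_joint[OF H(1) that] H(2) by (force simp: dicritical_def)
  then have "(\<lambda>j. 6 * j) ` {..Suc n} \<subseteq> verts H" by auto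
  moreover have "finite (verts H)"
    using H(1) finite_subset[OF _ finite_verts] by (auto simp: subgraph_def)
  ultimately have "card ((\<lambda>j::nat. 6 * j) ` {..Suc n}) \<le> card (verts H)" by (intro card_mono)
  also have "card ((\<lambda>j::nat. 6 * j) ` {..Suc n}) = Suc (Suc n)"
    by (subst card_image) (auto simp: inj_on_def)
  finally show ?thesis
    using H oriented_graph_subgraph[OF oriented_graph_axioms H(1)] by auto
qed

lemma digraph_iso_imp_card_verts_eq:
  assumes "digraph_iso D D'"
  shows "card (verts D) = card (verts D')"
  using assms
  by (auto simp: digraph_iso_def pre_digraph.digraph_isomorphism_def verts_app_iso card_image)

theorem corollary2p2:
  shows "\<exists>\<D> :: (nat, nat \<times> nat) pre_digraph set.
           infinite \<D> \<and>
           (\<forall>D\<in>\<D>. oriented_graph D \<and> dicritical 3 D) \<and>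
           pairwise (\<lambda>D D'. \<not> digraph_iso D D') \<D>"
proof -
  define S :: "(nat, nat \<times> nat) pre_digraph set"
    where "S = {D. oriented_graph D \<and> dicritical 3 D}"
  define order :: "(nat, nat \<times> nat) pre_digraph \<Rightarrow> nat" where "order D = card (verts D)" for D
  have orders: "infinite (order ` S)"
    unfolding infinite_nat_iff_unbounded
    using ex_large_3_dicritical_oriented_graph by (fastforce simp: S_def order_def)
  \<comment> \<open>Keep one digraph for each order that occurs.\<close>
  obtain \<D> where \<D>: "\<D> \<subseteq> S" "inj_on order \<D>" "order ` S = order ` \<D>"
    using subset_image_inj[of "order ` S" order S] by auto
  have "infinite \<D>" using orders \<D>(3) by auto
  moreover have "pairwise (\<lambda>D D'. \<not> digraph_iso D D') \<D>"
    using \<D>(2) digraph_iso_imp_card_verts_eq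
    by (fastforce simp: pairwise_def inj_on_def order_def)
  ultimately show ?thesis using \<D>(1) by (auto simp: S_def)
qed

end
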